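(* Let $\mu>0$, $L_{\rm c}>0$, $b_1,b_2,b_3>0$, let $\omega\subset\mathbb{R}^2$ be a bounded domain with Lipschitz boundary, and let $y_0$, $n_0$, $\mathrm{D}_x\Theta(0)$ and $\mathrm{A}_{y_0}$ be as in the context. Let $\overline{Q}_{e,0}:\omega\to\mathrm{SO}(3)$ be a microrotation field with first order partial derivatives and put $$\mathcal{K}_{\overline{Q}_{e,0}}:=\Big(\mathrm{axl}(\overline{Q}_{e,0}^T\partial_{x_1}\overline{Q}_{e,0})\,\big|\,\mathrm{axl}(\overline{Q}_{e,0}^T\partial_{x_2}\overline{Q}_{e,0})\,\big|\,0\Big)[\mathrm{D}_x\Theta(0)]^{-1}.$$ Consider the (pointwise) optimization problem $$\widetilde{W}^{\rm hom}_{\rm curv}(\mathcal{K}_{\overline{Q}_{e,0}}):=\inf_{A\in\mathfrak{so}(3)}\widetilde{W}_{\rm curv}\Big(\big(\mathrm{axl}(\overline{Q}_{e,0}^T\partial_{x_1}\overline{Q}_{e,0})\,\big|\,\mathrm{axl}(\overline{Q}_{e,0}^T\partial_{x_2}\overline{Q}_{e,0})\,\big|\,\mathrm{axl}(A)\big)[\mathrm{D}_x\Theta(0)]^{-1}\Big).$$ Its solution $A^*\in\mathfrak{so}(3)$ is given by $\mathrm{axl}(A^* )=c^*$ with $$c^*=\frac{b_2-b_1}{b_1+b_2}\,\mathcal{K}_{\overline{Q}_{e,0}}^T n_0-\frac{2b_3}{2(b_1+b_3)}\,\mathrm{tr}(\mathcal{K}_{\overline{Q}_{e,0}})\,n_0,$$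 and the corresponding homogenized curvature energy is $$\widetilde{W}^{\rm hom}_{\rm curv}(\mathcal{K}_{\overline{Q}_{e,0}})=\mu L_{\rm c}^2\Big(b_1\|\mathrm{sym}\,\mathcal{K}_{\overline{Q}_{e,0}}^\parallel\|^2+b_2\|\mathrm{skew}\,\mathcal{K}_{\overline{Q}_{e,0}}^\parallel\|^2+\frac{b_1b_3}{b_1+b_3}\big[\mathrm{tr}(\mathcal{K}_{\overline{Q}_{e,0}}^\parallel)\big]^2+\frac{2b_1b_2}{b_1+b_2}\|\mathcal{K}_{\overline{Q}_{e,0}}^\perp\|^2\Big),$$ where $\mathcal{K}_{\overline{Q}_{e,0}}^\parallel=\mathrm{A}_{y_0}\mathcal{K}_{\overline{Q}_{e,0}}$ and $\mathcal{K}_{\overline{Q}_{e,0}}^\perp=(\mathbb{1}_3-\mathrm{A}_{y_0})\mathcal{K}_{\overline{Q}_{e,0}}$ are the parts of the orthogonal decomposition of $\mathcal{K}_{\overline{Q}_{e,0}}$ in the tangential plane and in the normal direction, respectively.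
   Context: $\mathfrak{so}(3)$ is the space of skew-symmetric real $3\times3$ matrices; $\mathrm{axl}(A)\in\mathbb{R}^3$ is the axial vector of $A\in\mathfrak{so}(3)$, i.e. $Av=\mathrm{axl}(A)\times v$ for all $v\in\mathbb{R}^3$. $(z_1|z_2|z_3)$ denotes the matrix obtained by placing $z_1,z_2,z_3$ side by side as columns (or blocks). $\mathrm{sym}X=\frac12(X+X^T)$, $\mathrm{skew}X=\frac12(X-X^T)$, $\|X\|^2=\mathrm{tr}(XX^T)$, $\mathbb{1}_3$ is the identity matrix. Curvature energy: for $\Gamma\in\mathbb{R}^{3\times3}$, $\widetilde{W}_{\rm curv}(\Gamma)=\mu L_{\rm c}^2\big(b_1\|\mathrm{sym}\,\Gamma\|^2+b_2\|\mathrm{skew}\,\Gamma\|^2+b_3[\mathrm{tr}(\Gamma)]^2\big)$. Geometry: $y_0:\omega\to\mathbb{R}^3$ is a $C^2$ function (parametrizing the curved midsurface, with $\partial_{x_1}y_0,\partial_{x_2}y_0$ linearly independent), $n_0=\frac{\partial_{x_1}y_0\times\partial_{x_2}y_0}{\|\partial_{x_1}y_0\times\partial_{x_2}y_0\|}$ is the unit normal, $\Theta(x_1,x_2,x_3)=y_0(x_1,x_2)+x_3n_0(x_1,x_2)$, $\mathrm{D}_x\Theta(0)=(\mathrm{D}y_0|n_0)$ (the gradient of $\Theta$ at $x_3=0$, an invertible matrix), and $\mathrm{A}_{y_0}:=(\mathrm{D}y_0|0)[\mathrm{D}_x\Theta(0)]^{-1}\in\mathbb{R}^{3\times3}$. All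 expressions are evaluated pointwise in $\omega$, wherever the derivatives of $\overline{Q}_{e,0}$ exist. *)

theory Defs
  imports "HOL-Analysis.Analysis"
begin

text \<open>\<open>cols3 a b c\<close> is the matrix \<open>(a|b|c)\<close> with columns \<open>a\<close>, \<open>b\<close>, \<open>c\<close>.\<close>

definition cols3 :: "real^3 \<Rightarrow> real^3 \<Rightarrow> real^3 \<Rightarrow> real^3^3" where
  "cols3 a b c = transpose (vector [a, b, c])"

definition so3 :: "(real^3^3) set" where
  "so3 = {A. transpose A = - A}"

definition axl :: "real^3^3 \<Rightarrow> real^3" where
  "axl A = (THE a. \<forall>v. A *v v = cross3 a v)"

definition sym_part :: "real^3^3 \<Rightarrow> real^3^3" where
  "sym_part X = (1 / 2) *\<^sub>R (X + transpose X)"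

definition skew_part :: "real^3^3 \<Rightarrow> real^3^3" where
  "skew_part X = (1 / 2) *\<^sub>R (X - transpose X)"

text \<open>The library norm on matrices is the Frobenius norm.\<close>

lemma norm_matrix_square: "(norm X)\<^sup>2 = trace (X ** transpose X)" for X :: "real^3^3"
  by (simp add: power2_norm_eq_inner inner_vec_def trace_def matrix_matrix_mult_def transpose_def)

lemma so3_axl_unique:
  assumes "A \<in> so3"
  shows "\<exists>!a. \<forall>v. A *v v = cross3 a v"
proof (rule ex1I)
  have sk: "A $ j $ i = - A $ i $ j" for i j
  proof -
    have "transpose A $ i $ j = (- A) $ i $ j"
      using assms by (simp only: so3_def mem_Collect_eq)
    then show ?thesis by (simp only: transpose_def vec_lambda_beta vector_uminus_component)
  qed
  have d: "A $ i $ i = 0" for i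
    using sk[of i i] by linarith
  show "\<forall>v. A *v v = cross3 (vector [A$3$2, A$1$3, A$2$1]) v"
    using sk[of 1 2] sk[of 1 3] sk[of 2 3] d
    by (simp add: vec_eq_iff forall_3 cross3_def matrix_vector_mult_def sum_3 vector_3)
  fix b assume b: "\<forall>v. A *v v = cross3 b v"
  have "A *v axis i 1 = cross3 b (axis i 1)" for i
    using b by blast
  from this[of 1] this[of 2] this[of 3]
  show "b = vector [A$3$2, A$1$3, A$2$1]"
    by (simp add: vec_eq_iff forall_3 cross3_def matrix_vector_mult_def sum_3 vector_3 axis_def)
qed

lemma axl_cross3: "A \<in> so3 \<Longrightarrow> A *v v = cross3 (axl A) v"
  using theI'[OF so3_axl_unique, of A] unfolding axl_def by blast

definition partial :: "2 \<Rightarrow> (real^2 \<Rightarrow> 'b::real_normed_vector) \<Rightarrow> real^2 \<Rightarrow> 'b" where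
  "partial i f x = vector_derivative (\<lambda>t. f (x + t *\<^sub>R axis i 1)) (at 0)"

definition has_partial :: "2 \<Rightarrow> (real^2 \<Rightarrow> 'b::real_normed_vector) \<Rightarrow> real^2 \<Rightarrow> bool" where
  "has_partial i f x \<longleftrightarrow> (\<lambda>t. f (x + t *\<^sub>R axis i 1)) differentiable (at 0)"

text \<open>Intended for open \<open>S\<close>.\<close>

definition C1_on :: "(real^2) set \<Rightarrow> (real^2 \<Rightarrow> 'b::real_normed_vector) \<Rightarrow> bool" where
  "C1_on S f \<longleftrightarrow> (\<forall>x\<in>S. f differentiable (at x)) \<and> (\<forall>i. continuous_on S (partial i f))"

definition C2_on :: "(real^2) set \<Rightarrow> (real^2 \<Rightarrow> 'b::real_normed_vector) \<Rightarrow> bool" where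
  "C2_on S f \<longleftrightarrow> C1_on S f \<and> (\<forall>i. C1_on S (partial i f))"

text \<open>Near each boundary point \<open>p\<close>, in suitable orthonormal coordinates \<open>(s, t)\<close> centred at
  \<open>p\<close>, the set is the strict epigraph of a Lipschitz function \<open>g\<close> and its boundary is the graph.\<close>

definition lipschitz_boundary :: "(real^2) set \<Rightarrow> bool" where
  "lipschitz_boundary \<omega> \<longleftrightarrow>
     (\<forall>p\<in>frontier \<omega>. \<exists>e e' r h L g.
        norm e = 1 \<and> norm e' = 1 \<and> e \<bullet> e' = 0 \<and> 0 < r \<and> 0 < h \<and>
        L-lipschitz_on {-r<..<r} g \<and> (\<forall>s\<in>{-r<..<r}. \<bar>g s\<bar> < h) \<and>
        (\<forall>s\<in>{-r<..<r}. \<forall>t\<in>{-h<..<h}.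
           (p + s *\<^sub>R e + t *\<^sub>R e' \<in> \<omega> \<longleftrightarrow> g s < t) \<and>
           (p + s *\<^sub>R e + t *\<^sub>R e' \<in> frontier \<omega> \<longleftrightarrow> t = g s)))"

definition bounded_lipschitz_domain :: "(real^2) set \<Rightarrow> bool" where
  "bounded_lipschitz_domain \<omega> \<longleftrightarrow>
     open \<omega> \<and> connected \<omega> \<and> \<omega> \<noteq> {} \<and> bounded \<omega> \<and> lipschitz_boundary \<omega>"

text \<open>The two tangent vectors are linearly independent as a family, so they must also be distinct.\<close>

definition regular_at :: "(real^2 \<Rightarrow> real^3) \<Rightarrow> real^2 \<Rightarrow> bool" where
  "regular_at y\<^sub>0 x \<longleftrightarrow>
     partial 1 y\<^sub>0 x \<noteq> partial 2 y\<^sub>0 x \<and> independent {partial 1 y\<^sub>0 x, partial 2 y\<^sub>0 x}"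

definition unit_normal :: "(real^2 \<Rightarrow> real^3) \<Rightarrow> real^2 \<Rightarrow> real^3" where
  "unit_normal y\<^sub>0 x =
     cross3 (partial 1 y\<^sub>0 x) (partial 2 y\<^sub>0 x) /\<^sub>R norm (cross3 (partial 1 y\<^sub>0 x) (partial 2 y\<^sub>0 x))"

definition Theta :: "(real^2 \<Rightarrow> real^3) \<Rightarrow> real^3 \<Rightarrow> real^3" where
  "Theta y\<^sub>0 z = (let x = vector [z$1, z$2] in y\<^sub>0 x + (z$3) *\<^sub>R unit_normal y\<^sub>0 x)"

text \<open>\<open>D_Theta0 y\<^sub>0 x\<close> is \<open>D\<^sub>x\<Theta>(0) = (Dy\<^sub>0|n\<^sub>0)\<close> at \<open>x\<close>; lemma \<open>has_derivative_Theta\<close> below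
  identifies it with the gradient of \<open>Theta\<close> at \<open>x\<^sub>3 = 0\<close>.\<close>

definition D_Theta0 :: "(real^2 \<Rightarrow> real^3) \<Rightarrow> real^2 \<Rightarrow> real^3^3" where
  "D_Theta0 y\<^sub>0 x = cols3 (partial 1 y\<^sub>0 x) (partial 2 y\<^sub>0 x) (unit_normal y\<^sub>0 x)"

definition A_mid :: "(real^2 \<Rightarrow> real^3) \<Rightarrow> real^2 \<Rightarrow> real^3^3" where
  "A_mid y\<^sub>0 x = cols3 (partial 1 y\<^sub>0 x) (partial 2 y\<^sub>0 x) 0 ** matrix_inv (D_Theta0 y\<^sub>0 x)"

lemma partial_eq_derivative:
  assumes "(f has_derivative f') (at x)"
  shows "partial i f x = f' (axis i 1)"
proof -
  have "((\<lambda>t. x + t *\<^sub>R axis i 1) has_derivative (\<lambda>t. t *\<^sub>R axis i 1)) (at (0::real))"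
    by (auto intro!: derivative_eq_intros)
  then have "((\<lambda>t. f (x + t *\<^sub>R axis i 1)) has_derivative (\<lambda>t. f' (t *\<^sub>R axis i 1))) (at (0::real))"
    using has_derivative_compose[of "\<lambda>t. x + t *\<^sub>R axis i 1" _ "0::real" UNIV f f'] assms by simp
  then have "((\<lambda>t. f (x + t *\<^sub>R axis i 1)) has_vector_derivative f' (axis i 1)) (at 0)"
    using assms by (simp add: has_vector_derivative_def has_derivative_def bounded_linear.linear linear_cmul)
  then show ?thesis
    unfolding partial_def by (rule vector_derivative_at)
qed

lemma regular_at_cross3:
  assumes "regular_at y\<^sub>0 x"
  shows "cross3 (partial 1 y\<^sub>0 x) (partial 2 y\<^sub>0 x) \<noteq> 0"
proof
  let ?a = "partial 1 y\<^sub>0 x" and ?b = "partial 2 y\<^sub>0 x"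
  have ne: "?a \<noteq> ?b" and ind: "independent {?a, ?b}"
    using assms by (simp_all add: regular_at_def)
  have "?a \<noteq> 0" "?b \<noteq> 0"
    using ind dependent_zero[of "{?a, ?b}"] by auto
  moreover assume "cross3 ?a ?b = 0"
  ultimately obtain c where "?b = c *\<^sub>R ?a"
    unfolding cross_eq_0 collinear_lemma by blast
  then have "?b \<in> span {?a}"
    by (simp add: span_base span_scale)
  moreover have "{?a, ?b} - {?b} = {?a}"
    using ne by auto
  ultimately show False
    using ind unfolding dependent_def by (metis insertCI)
qed

lemma has_derivative_Theta:
  assumes "C2_on \<omega> y\<^sub>0" "x \<in> \<omega>" "regular_at y\<^sub>0 x"
  shows "(Theta y\<^sub>0 has_derivative (\<lambda>v. D_Theta0 y\<^sub>0 x *v v)) (at (vector [x$1, x$2, 0]))"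
proof -
  let ?P = "\<lambda>z::real^3. vector [z$1, z$2] :: real^2"
  let ?z = "vector [x$1, x$2, 0] :: real^3"
  have lin: "linear ?P"
    by (rule linearI) (simp_all add: vec_eq_iff forall_2)
  then have P: "(?P has_derivative ?P) (at ?z)"
    by (simp add: linear_imp_has_derivative)
  have Pz: "?P ?z = x"
    by (simp add: vec_eq_iff forall_2)
  obtain y' where y': "(y\<^sub>0 has_derivative y') (at x)"
    using assms(1,2) by (auto simp: C2_on_def C1_on_def differentiable_def)
  have d: "partial i y\<^sub>0 differentiable (at x)" for i
    using assms(1,2) by (auto simp: C2_on_def C1_on_def)
  have c: "(\<lambda>x. cross3 (partial 1 y\<^sub>0 x) (partial 2 y\<^sub>0 x)) differentiable (at x)"
    using bounded_bilinear.FDERIV[OF bilinear_cross[unfolded bilinear_conv_bounded_bilinear]] d[of 1] d[of 2]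
    unfolding differentiable_def by blast
  have "(\<lambda>x. norm (cross3 (partial 1 y\<^sub>0 x) (partial 2 y\<^sub>0 x))) differentiable (at x)"
    using differentiable_compose[OF _ c, of norm] differentiable_norm_at[OF regular_at_cross3[OF assms(3)]]
    by simp
  with c have "unit_normal y\<^sub>0 differentiable (at x)"
    unfolding unit_normal_def[abs_def] using regular_at_cross3[OF assms(3)]
    by (intro differentiable_scaleR differentiable_inverse) auto
  then obtain n' where n': "(unit_normal y\<^sub>0 has_derivative n') (at x)"
    by (auto simp: differentiable_def)
  have Y: "((\<lambda>z. y\<^sub>0 (?P z)) has_derivative (\<lambda>v. y' (?P v))) (at ?z)"
    using has_derivative_compose[OF P, of y\<^sub>0 y'] y' Pz by simp
  have N: "((\<lambda>z. unit_normal y\<^sub>0 (?P z)) has_derivative (\<lambda>v. n' (?P v))) (at ?z)"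
    using has_derivative_compose[OF P, of "unit_normal y\<^sub>0" n'] n' Pz by simp
  have c3: "((\<lambda>z::real^3. z$3) has_derivative (\<lambda>z. z$3)) (at ?z)"
    by (simp add: bounded_linear_imp_has_derivative bounded_linear_vec_nth)
  have "((\<lambda>z. y\<^sub>0 (?P z) + (z$3) *\<^sub>R unit_normal y\<^sub>0 (?P z)) has_derivative
      (\<lambda>v. y' (?P v) + ((?z$3) *\<^sub>R n' (?P v) + (v$3) *\<^sub>R unit_normal y\<^sub>0 (?P ?z)))) (at ?z)"
    by (intro has_derivative_add Y has_derivative_scaleR c3 N)
  moreover have "y' (?P v) + ((?z$3) *\<^sub>R n' (?P v) + (v$3) *\<^sub>R unit_normal y\<^sub>0 (?P ?z)) = D_Theta0 y\<^sub>0 x *v v" for v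
  proof -
    have "?P v = v$1 *\<^sub>R axis 1 1 + v$2 *\<^sub>R axis 2 1"
      by (simp add: vec_eq_iff forall_2 axis_def)
    then have "y' (?P v) = v$1 *\<^sub>R partial 1 y\<^sub>0 x + v$2 *\<^sub>R partial 2 y\<^sub>0 x"
      using has_derivative_linear[OF y'] by (simp add: partial_eq_derivative[OF y'] linear_add linear_cmul)
    then show ?thesis
      unfolding Pz by (simp add: D_Theta0_def cols3_def vec_eq_iff forall_3 matrix_vector_mult_def sum_3 transpose_def vector_3)
  qed
  ultimately show ?thesis
    unfolding Theta_def[abs_def] Let_def by simp
qed

definition W_curv :: "real \<Rightarrow> real \<Rightarrow> real \<Rightarrow> real \<Rightarrow> real \<Rightarrow> real^3^3 \<Rightarrow> real" where
  "W_curv \<mu> L\<^sub>c b\<^sub>1 b\<^sub>2 b\<^sub>3 \<Gamma> =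
     \<mu> * L\<^sub>c\<^sup>2 * (b\<^sub>1 * (norm (sym_part \<Gamma>))\<^sup>2 + b\<^sub>2 * (norm (skew_part \<Gamma>))\<^sup>2 + b\<^sub>3 * (trace \<Gamma>)\<^sup>2)"

text \<open>\<open>Gamma_curv y\<^sub>0 Q x c\<close> is
  \<open>(axl(Q\<^sup>T \<partial>\<^sub>1Q) | axl(Q\<^sup>T \<partial>\<^sub>2Q) | c) [D\<^sub>x\<Theta>(0)]\<^sup>-\<^sup>1\<close> at the point \<open>x\<close>.\<close>

definition Gamma_curv ::
    "(real^2 \<Rightarrow> real^3) \<Rightarrow> (real^2 \<Rightarrow> real^3^3) \<Rightarrow> real^2 \<Rightarrow> real^3 \<Rightarrow> real^3^3" where
  "Gamma_curv y\<^sub>0 Q x c =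
     cols3 (axl (transpose (Q x) ** partial 1 Q x)) (axl (transpose (Q x) ** partial 2 Q x)) c
       ** matrix_inv (D_Theta0 y\<^sub>0 x)"

definition K_curv :: "(real^2 \<Rightarrow> real^3) \<Rightarrow> (real^2 \<Rightarrow> real^3^3) \<Rightarrow> real^2 \<Rightarrow> real^3^3" where
  "K_curv y\<^sub>0 Q x = Gamma_curv y\<^sub>0 Q x 0"

definition K_par :: "(real^2 \<Rightarrow> real^3) \<Rightarrow> (real^2 \<Rightarrow> real^3^3) \<Rightarrow> real^2 \<Rightarrow> real^3^3" where
  "K_par y\<^sub>0 Q x = A_mid y\<^sub>0 x ** K_curv y\<^sub>0 Q x"

definition K_perp :: "(real^2 \<Rightarrow> real^3) \<Rightarrow> (real^2 \<Rightarrow> real^3^3) \<Rightarrow> real^2 \<Rightarrow> real^3^3" where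
  "K_perp y\<^sub>0 Q x = (mat 1 - A_mid y\<^sub>0 x) ** K_curv y\<^sub>0 Q x"

definition W_hom_curv ::
    "real \<Rightarrow> real \<Rightarrow> real \<Rightarrow> real \<Rightarrow> real \<Rightarrow>
     (real^2 \<Rightarrow> real^3) \<Rightarrow> (real^2 \<Rightarrow> real^3^3) \<Rightarrow> real^2 \<Rightarrow> real" where
  "W_hom_curv \<mu> L\<^sub>c b\<^sub>1 b\<^sub>2 b\<^sub>3 y\<^sub>0 Q x =
     (INF A\<in>so3. W_curv \<mu> L\<^sub>c b\<^sub>1 b\<^sub>2 b\<^sub>3 (Gamma_curv y\<^sub>0 Q x (axl A)))"

end

theory Submission
  imports Defs
begin

text \<open>
  Write \<open>a\<close>, \<open>b\<close> for the two tangent vectors and \<open>n\<close> for the unit normal at \<open>x\<close>. Since \<open>n\<close> is a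
  unit vector orthogonal to \<open>a\<close> and \<open>b\<close>, the third row of \<open>(a|b|n)\<^sup>-\<^sup>1\<close> is \<open>n\<^sup>T\<close>. Hence replacing the
  third column \<open>0\<close> by \<open>c\<close> changes \<open>\<K>\<close> by the rank-one matrix \<open>c n\<^sup>T\<close>, the matrix \<open>A\<close> of the
  midsurface is the orthogonal projection \<open>1 - n n\<^sup>T\<close>, and \<open>\<K> n = 0\<close>
  (lemmas \<open>Gamma_curv_eq\<close>, \<open>A_mid_eq\<close>, \<open>K_curv_normal\<close>).

  The energy depends on \<open>\<Gamma>\<close> only through \<open>\<Gamma> \<bullet> \<Gamma>\<close>, \<open>\<Gamma> \<bullet> \<Gamma>\<^sup>T\<close> and \<open>tr \<Gamma>\<close>, so that
  \<open>\<Gamma> = \<K> + c n\<^sup>T\<close> makes it a quadratic polynomial in \<open>c\<close> which involves \<open>\<K>\<close> only through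
  three constants and the tangential vector \<open>k = \<K>\<^sup>T n\<close> (lemma \<open>W_curv_add_outer\<close>). Completing the
  square separately in the tangential and the normal component of \<open>c\<close> exhibits \<open>c\<^sup>*\<close> and shows that
  the energy exceeds its value at \<open>c\<^sup>*\<close> by a positive definite form in \<open>c - c\<^sup>*\<close>
  (lemma \<open>W_curv_excess\<close>), which gives existence and uniqueness of the minimizer.

  For the minimal value, the projection splits \<open>\<K>\<close> into \<open>\<K>\<^sup>\<parallel> = \<K> - n k\<^sup>T\<close> and
  \<open>\<K>\<^sup>\<bottom> = n k\<^sup>T\<close>. Because \<open>\<K> n = 0\<close> and
  \<open>k \<bullet> n = 0\<close>, this changes neither the trace nor \<open>\<K> \<bullet> \<K>\<^sup>T\<close>, and it
  lowers \<open>\<K> \<bullet> \<K>\<close> by \<open>|k|\<^sup>2 = |\<K>\<^sup>\<bottom>|\<^sup>2\<close>; inserting \<open>c\<^sup>*\<close> turns the coefficient of \<open>|k|\<^sup>2\<close> into the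
  harmonic mean of \<open>b\<^sub>1\<close> and \<open>b\<^sub>2\<close> (lemma \<open>W_curv_minimum\<close>). Finally \<open>A \<mapsto> axl A\<close> is a bijection of
  \<open>so(3)\<close> onto \<open>\<real>\<^sup>3\<close>, which transfers the result from \<open>c\<close> to \<open>A\<close>.
\<close>

section \<open>Rank-one matrices\<close>

definition outer :: "real^'m \<Rightarrow> real^'n \<Rightarrow> real^'n^'m" where
  "outer u v = (\<chi> i j. u $ i * v $ j)"

lemma outer_vector_mult: "outer u v *v w = (v \<bullet> w) *\<^sub>R u"
  by (simp add: outer_def matrix_vector_mult_def vec_eq_iff inner_vec_def sum_distrib_left mult_ac)

lemma transpose_outer: "transpose (outer u v) = outer v u"
  by (simp add: outer_def transpose_def vec_eq_iff mult_ac)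

lemma outer_matrix_mult: "outer u v ** M = outer u (transpose M *v v)"
  by (simp add: outer_def matrix_matrix_mult_def matrix_vector_mult_def transpose_def vec_eq_iff
      sum_distrib_left mult_ac)

lemma trace_outer: "trace (outer u v) = u \<bullet> v"
  by (simp add: outer_def trace_def inner_vec_def)

lemma inner_outer: "X \<bullet> outer u v = u \<bullet> (X *v v)"
  by (simp add: outer_def inner_vec_def matrix_vector_mult_def sum_distrib_left mult_ac)

lemma inner_transpose: "transpose X \<bullet> transpose Y = X \<bullet> (Y :: real^'n^'m)"
  unfolding inner_vec_def transpose_def by (simp add: sum.swap[of _ "UNIV :: 'n set"])

lemma transpose_add: "transpose (X + Y) = transpose X + transpose (Y :: real^'n^'m)"
  by (simp add: transpose_def vec_eq_iff)

lemma transpose_diff: "transpose (X - Y) = transpose X - transpose (Y :: real^'n^'m)"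
  by (simp add: transpose_def vec_eq_iff)

lemma matrix_mult_add_left: "(A + B) ** C = A ** C + B ** (C :: real^'n^'m)"
  by (simp add: matrix_matrix_mult_def vec_eq_iff distrib_right sum.distrib)

section \<open>The curvature energy under a rank-one perturbation\<close>

lemma norm_sym_part_square: "(norm (sym_part X))\<^sup>2 = (X \<bullet> X + X \<bullet> transpose X) / 2"
  using inner_transpose[of X X]
  by (simp add: power2_norm_eq_inner sym_part_def inner_add inner_commute field_simps)

lemma norm_skew_part_square: "(norm (skew_part X))\<^sup>2 = (X \<bullet> X - X \<bullet> transpose X) / 2"
  using inner_transpose[of X X]
  by (simp add: power2_norm_eq_inner skew_part_def inner_diff inner_commute field_simps)

text \<open>The mixed term of \<open>\<Gamma> \<bullet> \<Gamma>\<close> vanishes because \<open>K n = 0\<close>; the one of \<open>\<Gamma> \<bullet> \<Gamma>\<^sup>T\<close> need not, and it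
  is what gives the minimizer its component along \<open>K\<^sup>T n\<close>.\<close>

lemma W_curv_add_outer:
  assumes "K *v n = 0" "n \<bullet> n = 1"
  shows "W_curv \<mu> L b\<^sub>1 b\<^sub>2 b\<^sub>3 (K + outer c n) =
    \<mu> * L\<^sup>2 * ((b\<^sub>1 + b\<^sub>2) / 2 * (K \<bullet> K + c \<bullet> c)
      + (b\<^sub>1 - b\<^sub>2) / 2 * (K \<bullet> transpose K + 2 * (c \<bullet> (transpose K *v n)) + (c \<bullet> n)\<^sup>2)
      + b\<^sub>3 * (trace K + c \<bullet> n)\<^sup>2)"
proof -
  let ?G = "K + outer c n"
  have GG: "?G \<bullet> ?G = K \<bullet> K + c \<bullet> c"
    using assms
    by (simp add: inner_add inner_outer matrix_vector_mult_add_rdistrib outer_vector_mult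
        inner_commute[of "outer c n" K])
  have "K \<bullet> outer n c = outer c n \<bullet> transpose K"
    using inner_transpose[of K "outer n c"] by (simp add: transpose_outer inner_commute)
  then have GT: "?G \<bullet> transpose ?G
      = K \<bullet> transpose K + 2 * (c \<bullet> (transpose K *v n)) + (c \<bullet> n)\<^sup>2"
    by (simp add: transpose_add transpose_outer inner_add inner_outer outer_vector_mult
        inner_commute[of "outer c n" "transpose K"] power2_eq_square inner_commute)
  have T: "trace ?G = trace K + c \<bullet> n"
    by (simp add: trace_add trace_outer)
  show ?thesis
    unfolding W_curv_def norm_sym_part_square norm_skew_part_square GG GT T
    by (simp add: field_simps)
qed

lemma inner_transpose_mult_null:
  fixes K :: "real^'n^'n"
  assumes "K *v n = 0"
  shows "(transpose K *v n) \<bullet> n = 0"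
  using assms dot_lmul_matrix[of n K n] by simp

definition optimal_column :: "real \<Rightarrow> real \<Rightarrow> real \<Rightarrow> real^3^3 \<Rightarrow> real^3 \<Rightarrow> real^3" where
  "optimal_column b\<^sub>1 b\<^sub>2 b\<^sub>3 K n =
     ((b\<^sub>2 - b\<^sub>1) / (b\<^sub>1 + b\<^sub>2)) *\<^sub>R (transpose K *v n) - (b\<^sub>3 / (b\<^sub>1 + b\<^sub>3) * trace K) *\<^sub>R n"

text \<open>With \<open>d = c - c\<^sup>*\<close>, the tangential part of \<open>d\<close> carries the weight \<open>(b\<^sub>1 + b\<^sub>2) / 2\<close> and its normal
  part the weight \<open>b\<^sub>1 + b\<^sub>3\<close>: a normal column contributes to the symmetric part and the trace only.\<close>

lemma W_curv_excess:
  assumes "K *v n = 0" "n \<bullet> n = 1" "b\<^sub>1 + b\<^sub>2 \<noteq> 0" "b\<^sub>1 + b\<^sub>3 \<noteq> 0"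
  defines "s \<equiv> optimal_column b\<^sub>1 b\<^sub>2 b\<^sub>3 K n"
  shows "W_curv \<mu> L b\<^sub>1 b\<^sub>2 b\<^sub>3 (K + outer c n) = W_curv \<mu> L b\<^sub>1 b\<^sub>2 b\<^sub>3 (K + outer s n)
    + \<mu> * L\<^sup>2 * ((b\<^sub>1 + b\<^sub>2) / 2 * (norm ((c - s) - ((c - s) \<bullet> n) *\<^sub>R n))\<^sup>2
      + (b\<^sub>1 + b\<^sub>3) * ((c - s) \<bullet> n)\<^sup>2)"
proof -
  define k where "k = transpose K *v n"
  define d where "d = c - s"
  define \<alpha> where "\<alpha> = (b\<^sub>2 - b\<^sub>1) / (b\<^sub>1 + b\<^sub>2)"
  define \<beta> where "\<beta> = b\<^sub>3 / (b\<^sub>1 + b\<^sub>3)"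
  define t where "t = trace K"
  define p where "p = d \<bullet> n"
  have kn: "k \<bullet> n = 0"
    unfolding k_def using assms(1) by (rule inner_transpose_mult_null)
  have s: "s = \<alpha> *\<^sub>R k - (\<beta> * t) *\<^sub>R n"
    by (simp add: s_def optimal_column_def k_def \<alpha>_def \<beta>_def t_def)
  have c: "c = s + d"
    by (simp add: d_def)
  have sn: "s \<bullet> n = - \<beta> * t"
    using kn assms(2) by (simp add: s inner_diff)
  have sd: "s \<bullet> d = \<alpha> * (d \<bullet> k) - \<beta> * t * p"
    by (simp add: s inner_diff inner_commute p_def)
  have cc: "c \<bullet> c = s \<bullet> s + 2 * (\<alpha> * (d \<bullet> k) - \<beta> * t * p) + d \<bullet> d"
    unfolding c using sd by (simp add: inner_add inner_commute)
  have ck: "c \<bullet> k = s \<bullet> k + d \<bullet> k"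
    by (simp add: c inner_add)
  have cn: "c \<bullet> n = p - \<beta> * t"
    using sn by (simp add: c inner_add p_def)
  have proj: "(norm (d - p *\<^sub>R n))\<^sup>2 = d \<bullet> d - p\<^sup>2"
    unfolding power2_norm_eq_inner using assms(2)
    by (simp add: inner_diff p_def inner_commute power2_eq_square)
  have \<alpha>: "(b\<^sub>1 + b\<^sub>2) * \<alpha> = b\<^sub>2 - b\<^sub>1" and \<beta>: "(b\<^sub>1 + b\<^sub>3) * \<beta> = b\<^sub>3"
    using assms(3,4) by (simp_all add: \<alpha>_def \<beta>_def)
  \<comment> \<open>The terms linear in \<open>d\<close> cancel by the defining equations of \<open>\<alpha>\<close> and \<open>\<beta>\<close>.\<close>
  have "(b\<^sub>1 + b\<^sub>2) / 2 * (K \<bullet> K + c \<bullet> c)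
      + (b\<^sub>1 - b\<^sub>2) / 2 * (K \<bullet> transpose K + 2 * (c \<bullet> k) + (c \<bullet> n)\<^sup>2) + b\<^sub>3 * (t + c \<bullet> n)\<^sup>2
    - ((b\<^sub>1 + b\<^sub>2) / 2 * (K \<bullet> K + s \<bullet> s)
      + (b\<^sub>1 - b\<^sub>2) / 2 * (K \<bullet> transpose K + 2 * (s \<bullet> k) + (s \<bullet> n)\<^sup>2) + b\<^sub>3 * (t + s \<bullet> n)\<^sup>2)
    = ((b\<^sub>1 + b\<^sub>2) * \<alpha> - (b\<^sub>2 - b\<^sub>1)) * (d \<bullet> k) - 2 * p * t * ((b\<^sub>1 + b\<^sub>3) * \<beta> - b\<^sub>3)
      + ((b\<^sub>1 + b\<^sub>2) / 2 * (d \<bullet> d - p\<^sup>2) + (b\<^sub>1 + b\<^sub>3) * p\<^sup>2)"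
    unfolding cc ck cn sn by (simp add: field_simps power2_eq_square)
  then show ?thesis
    unfolding W_curv_add_outer[OF assms(1,2)] d_def[symmetric] p_def[symmetric] proj
      k_def[symmetric] t_def[symmetric] \<alpha> \<beta>
    by (simp add: distrib_left[symmetric])
qed

lemma W_curv_excess_pos:
  assumes "K *v n = 0" "n \<bullet> n = 1" "\<mu> > 0" "L > 0" "b\<^sub>1 > 0" "b\<^sub>2 > 0" "b\<^sub>3 > 0"
    and "c \<noteq> optimal_column b\<^sub>1 b\<^sub>2 b\<^sub>3 K n"
  shows "W_curv \<mu> L b\<^sub>1 b\<^sub>2 b\<^sub>3 (K + outer (optimal_column b\<^sub>1 b\<^sub>2 b\<^sub>3 K n) n)
    < W_curv \<mu> L b\<^sub>1 b\<^sub>2 b\<^sub>3 (K + outer c n)"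
proof -
  define d where "d = c - optimal_column b\<^sub>1 b\<^sub>2 b\<^sub>3 K n"
  have "d \<noteq> 0"
    using assms(8) by (simp add: d_def)
  then have "d - (d \<bullet> n) *\<^sub>R n \<noteq> 0 \<or> d \<bullet> n \<noteq> 0"
    by force
  then have "(b\<^sub>1 + b\<^sub>2) / 2 * (norm (d - (d \<bullet> n) *\<^sub>R n))\<^sup>2 + (b\<^sub>1 + b\<^sub>3) * (d \<bullet> n)\<^sup>2 > 0"
    using assms(5-7) by (auto intro: add_pos_nonneg add_nonneg_pos)
  then show ?thesis
    using W_curv_excess[OF assms(1,2), of b\<^sub>1 b\<^sub>2 b\<^sub>3 \<mu> L c] assms(3-7) by (simp add: d_def)
qed

text \<open>The two summands \<open>K - n k\<^sup>T\<close> and \<open>n k\<^sup>T\<close>, with \<open>k = K\<^sup>T n\<close>, are the images of \<open>K\<close> under the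
  projections \<open>1 - n n\<^sup>T\<close> and \<open>n n\<^sup>T\<close>.\<close>

lemma W_curv_minimum:
  assumes "K *v n = 0" "n \<bullet> n = 1" "b\<^sub>1 > 0" "b\<^sub>2 > 0" "b\<^sub>3 > 0"
  defines "N \<equiv> outer n (transpose K *v n)"
  shows "W_curv \<mu> L b\<^sub>1 b\<^sub>2 b\<^sub>3 (K + outer (optimal_column b\<^sub>1 b\<^sub>2 b\<^sub>3 K n) n) =
    \<mu> * L\<^sup>2 * (b\<^sub>1 * (norm (sym_part (K - N)))\<^sup>2 + b\<^sub>2 * (norm (skew_part (K - N)))\<^sup>2
      + b\<^sub>1 * b\<^sub>3 / (b\<^sub>1 + b\<^sub>3) * (trace (K - N))\<^sup>2 + 2 * b\<^sub>1 * b\<^sub>2 / (b\<^sub>1 + b\<^sub>2) * (norm N)\<^sup>2)"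
proof -
  define k where "k = transpose K *v n"
  define \<alpha> where "\<alpha> = (b\<^sub>2 - b\<^sub>1) / (b\<^sub>1 + b\<^sub>2)"
  define \<beta> where "\<beta> = b\<^sub>3 / (b\<^sub>1 + b\<^sub>3)"
  define t where "t = trace K"
  define s where "s = optimal_column b\<^sub>1 b\<^sub>2 b\<^sub>3 K n"
  have kn: "k \<bullet> n = 0"
    unfolding k_def using assms(1) by (rule inner_transpose_mult_null)
  have Kk: "n \<bullet> (K *v k) = k \<bullet> k"
    unfolding k_def by (metis dot_lmul_matrix transpose_matrix_vector)
  have N: "N = outer n k"
    by (simp add: N_def k_def)
  have NN: "N \<bullet> N = k \<bullet> k" and KN: "K \<bullet> N = k \<bullet> k"
    using assms(2) Kk by (simp_all add: N inner_outer outer_vector_mult)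
  have PP: "(K - N) \<bullet> (K - N) = K \<bullet> K - k \<bullet> k"
    using NN KN by (simp add: inner_diff inner_commute)
  have "K \<bullet> transpose N = 0"
    using assms(1) by (simp add: N transpose_outer inner_outer)
  moreover from this have "N \<bullet> transpose K = 0"
    using inner_transpose[of "transpose K" N] by (simp add: inner_commute)
  moreover have "N \<bullet> transpose N = 0"
    using kn by (simp add: N transpose_outer inner_outer outer_vector_mult)
  ultimately have PT: "(K - N) \<bullet> transpose (K - N) = K \<bullet> transpose K"
    by (simp add: transpose_diff inner_diff)
  have T: "trace (K - N) = t"
    using kn by (simp add: N t_def trace_sub trace_outer inner_commute)
  have s: "s = \<alpha> *\<^sub>R k - (\<beta> * t) *\<^sub>R n"
    by (simp add: s_def optimal_column_def k_def \<alpha>_def \<beta>_def t_def)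
  have sk: "s \<bullet> k = \<alpha> * (k \<bullet> k)" and sn: "s \<bullet> n = - \<beta> * t"
    using kn assms(2) by (simp_all add: s inner_diff inner_commute)
  have ss: "s \<bullet> s = \<alpha>\<^sup>2 * (k \<bullet> k) + \<beta>\<^sup>2 * t\<^sup>2"
    using kn assms(2) by (simp add: s inner_diff inner_commute power2_eq_square)
  have \<alpha>: "(b\<^sub>1 + b\<^sub>2) / 2 * (1 + \<alpha>\<^sup>2) + (b\<^sub>1 - b\<^sub>2) * \<alpha> = 2 * b\<^sub>1 * b\<^sub>2 / (b\<^sub>1 + b\<^sub>2)"
    unfolding \<alpha>_def using assms(3,4) by (simp add: divide_simps power2_eq_square) algebra
  have \<beta>: "b\<^sub>1 * \<beta>\<^sup>2 + b\<^sub>3 * (1 - \<beta>)\<^sup>2 = b\<^sub>1 * b\<^sub>3 / (b\<^sub>1 + b\<^sub>3)"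
    unfolding \<beta>_def using assms(3,5) by (simp add: divide_simps power2_eq_square) algebra
  have "(b\<^sub>1 + b\<^sub>2) / 2 * (K \<bullet> K + s \<bullet> s)
      + (b\<^sub>1 - b\<^sub>2) / 2 * (K \<bullet> transpose K + 2 * (s \<bullet> k) + (s \<bullet> n)\<^sup>2) + b\<^sub>3 * (t + s \<bullet> n)\<^sup>2
    = b\<^sub>1 * ((K \<bullet> K - k \<bullet> k + K \<bullet> transpose K) / 2) + b\<^sub>2 * ((K \<bullet> K - k \<bullet> k - K \<bullet> transpose K) / 2)
      + (b\<^sub>1 * \<beta>\<^sup>2 + b\<^sub>3 * (1 - \<beta>)\<^sup>2) * t\<^sup>2
      + ((b\<^sub>1 + b\<^sub>2) / 2 * (1 + \<alpha>\<^sup>2) + (b\<^sub>1 - b\<^sub>2) * \<alpha>) * (k \<bullet> k)"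
    unfolding ss sk sn by (simp add: field_simps power2_eq_square)
  then show ?thesis
    unfolding s_def[symmetric] W_curv_add_outer[OF assms(1,2)] norm_sym_part_square
      norm_skew_part_square PP PT T power2_norm_eq_inner[of N] NN k_def[symmetric]
      t_def[symmetric] \<alpha> \<beta>
    by simp
qed

section \<open>The frame of tangent vectors and unit normal\<close>

lemma cols3_add_outer: "cols3 a b c = cols3 a b 0 + outer c (axis 3 1)"
  by (simp add: cols3_def outer_def vec_eq_iff forall_3 transpose_def vector_3 axis_def)

lemma cols3_mult: "cols3 a b c *v v = v$1 *\<^sub>R a + v$2 *\<^sub>R b + v$3 *\<^sub>R c"
  by (simp add: cols3_def vec_eq_iff forall_3 matrix_vector_mult_def sum_3 transpose_def vector_3)

lemma transpose_cols3_mult: "transpose (cols3 a b c) *v v = vector [a \<bullet> v, b \<bullet> v, c \<bullet> v]"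
  by (simp add: cols3_def vec_eq_iff forall_3 matrix_vector_mult_def sum_3 transpose_transpose
      vector_3 inner_vec_def)

lemma unit_normal_props:
  assumes "regular_at y x"
  shows inner_unit_normal: "unit_normal y x \<bullet> unit_normal y x = 1"
    and tangent1_normal: "partial 1 y x \<bullet> unit_normal y x = 0"
    and tangent2_normal: "partial 2 y x \<bullet> unit_normal y x = 0"
    and invertible_D_Theta0: "invertible (D_Theta0 y x)"
proof -
  let ?a = "partial 1 y x" and ?b = "partial 2 y x"
  let ?w = "cross3 ?a ?b"
  have w: "?w \<noteq> 0"
    using assms by (rule regular_at_cross3)
  then show "unit_normal y x \<bullet> unit_normal y x = 1"
    by (simp add: unit_normal_def dot_square_norm power2_eq_square)
  show "?a \<bullet> unit_normal y x = 0" "?b \<bullet> unit_normal y x = 0"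
    by (simp_all add: unit_normal_def dot_cross_self)
  have "det (D_Theta0 y x) = ?w \<bullet> unit_normal y x"
    unfolding D_Theta0_def cols3_def det_transpose
    by (simp add: det_3 vector_3 cross3_def inner_vec_def sum_3 algebra_simps)
  also have "\<dots> \<noteq> 0"
    using w by (simp add: unit_normal_def)
  finally show "invertible (D_Theta0 y x)"
    by (simp add: invertible_det_nz)
qed

lemma matrix_inv_D_Theta0:
  assumes "regular_at y x"
  shows "D_Theta0 y x ** matrix_inv (D_Theta0 y x) = mat 1"
    and "matrix_inv (D_Theta0 y x) ** D_Theta0 y x = mat 1"
  using someI_ex[OF invertible_D_Theta0[OF assms, unfolded invertible_def]]
  unfolding matrix_inv_def by blast+

text \<open>That \<open>n\<close> is a unit vector orthogonal to \<open>a\<close> and \<open>b\<close> says \<open>n\<^sup>T (a|b|n) = e\<^sub>3\<^sup>T\<close>; multiplying by the inverse from the right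
  identifies its third row as \<open>n\<^sup>T\<close>.\<close>

lemma matrix_inv_D_Theta0_row3:
  assumes "regular_at y x"
  shows "transpose (matrix_inv (D_Theta0 y x)) *v axis 3 1 = unit_normal y x"
proof -
  let ?D = "D_Theta0 y x"
  have "transpose ?D *v unit_normal y x = axis 3 1"
    using unit_normal_props(1-3)[OF assms]
    by (simp add: D_Theta0_def transpose_cols3_mult vec_eq_iff forall_3 vector_3 axis_def
        del: transpose_matrix_vector)
  then have "transpose (matrix_inv ?D) *v axis 3 1
      = (transpose (matrix_inv ?D) ** transpose ?D) *v unit_normal y x"
    by (simp only: matrix_vector_mul_assoc[symmetric])
  also have "\<dots> = unit_normal y x"
    by (simp only: matrix_transpose_mul[symmetric] matrix_inv_D_Theta0[OF assms] transpose_mat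
        matrix_vector_mul_lid)
  finally show ?thesis .
qed

lemma matrix_inv_D_Theta0_normal:
  assumes "regular_at y x"
  shows "matrix_inv (D_Theta0 y x) *v unit_normal y x = axis 3 1"
proof -
  have "unit_normal y x = D_Theta0 y x *v axis 3 1"
    by (simp add: D_Theta0_def cols3_mult axis_def)
  then show ?thesis
    by (simp add: matrix_vector_mul_assoc matrix_inv_D_Theta0[OF assms])
qed

lemma Gamma_curv_eq:
  assumes "regular_at y x"
  shows "Gamma_curv y Q x c = K_curv y Q x + outer c (unit_normal y x)"
  unfolding Gamma_curv_def K_curv_def
  by (subst cols3_add_outer)
    (simp only: matrix_mult_add_left outer_matrix_mult matrix_inv_D_Theta0_row3[OF assms])

lemma K_curv_normal:
  assumes "regular_at y x"
  shows "K_curv y Q x *v unit_normal y x = 0"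
  by (simp add: K_curv_def Gamma_curv_def matrix_vector_mul_assoc[symmetric]
      matrix_inv_D_Theta0_normal[OF assms] cols3_mult axis_def)

lemma A_mid_eq:
  assumes "regular_at y x"
  shows "A_mid y x = mat 1 - outer (unit_normal y x) (unit_normal y x)"
proof -
  have "mat 1 = A_mid y x + outer (unit_normal y x) (unit_normal y x)"
    unfolding matrix_inv_D_Theta0(1)[OF assms, symmetric] A_mid_def
    by (subst D_Theta0_def, subst cols3_add_outer)
      (simp only: matrix_mult_add_left outer_matrix_mult matrix_inv_D_Theta0_row3[OF assms])
  then show ?thesis
    by simp
qed

lemma K_perp_eq:
  assumes "regular_at y x"
  shows "K_perp y Q x = outer (unit_normal y x) (transpose (K_curv y Q x) *v unit_normal y x)"
  by (simp add: K_perp_def A_mid_eq[OF assms] outer_matrix_mult)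

lemma K_curv_split: "K_curv y Q x = K_par y Q x + K_perp y Q x"
  by (simp add: K_par_def K_perp_def matrix_mult_add_left[symmetric])

lemma K_par_tangential: "K_par y Q x *v v \<in> span {partial 1 y x, partial 2 y x}"
  by (simp add: K_par_def A_mid_def matrix_vector_mul_assoc[symmetric] cols3_mult
      span_add span_scale span_base)

lemma K_perp_normal:
  assumes "regular_at y x"
  shows "K_perp y Q x *v v \<in> span {unit_normal y x}"
  by (simp add: K_perp_eq[OF assms] outer_vector_mult span_scale span_base)

text \<open>\<open>K_perp\<close> has the form \<open>n k\<^sup>T\<close>, so the inner product with it only sees \<open>n\<^sup>T K_par\<close>, which is zero
  as the range of \<open>K_par\<close> is tangential.\<close>

lemma K_par_perp_orthogonal:
  assumes "regular_at y x"
  shows "K_par y Q x \<bullet> K_perp y Q x = 0"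
proof -
  let ?n = "unit_normal y x"
  have "orthogonal ?n z" if "z \<in> span {partial 1 y x, partial 2 y x}" for z
    using that
    by (rule orthogonal_to_span)
      (use unit_normal_props(2,3)[OF assms] in \<open>auto simp: orthogonal_def inner_commute\<close>)
  then show ?thesis
    using K_par_tangential by (simp add: K_perp_eq[OF assms] inner_outer orthogonal_def)
qed

section \<open>Axial vectors parametrize the skew-symmetric matrices\<close>

lemma axl_inj: "A \<in> so3 \<Longrightarrow> B \<in> so3 \<Longrightarrow> axl A = axl B \<Longrightarrow> A = B"
  by (simp add: matrix_eq axl_cross3)

lemma axl_surj: "\<exists>A\<in>so3. axl A = c"
proof
  let ?A = "cols3 (cross3 c (axis 1 1)) (cross3 c (axis 2 1)) (cross3 c (axis 3 1))"
  show so: "?A \<in> so3"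
    by (simp add: so3_def cols3_def cross3_def vec_eq_iff forall_3 transpose_def vector_3 axis_def)
  have "?A *v v = cross3 c v" for v
    by (simp add: cols3_mult cross3_def vec_eq_iff forall_3 vector_3 axis_def algebra_simps)
  then show "axl ?A = c"
    using so3_axl_unique[OF so] axl_cross3[OF so] by metis
qed

section \<open>The homogenized curvature energy\<close>

theorem theorem4p3:
  fixes \<mu> L\<^sub>c b\<^sub>1 b\<^sub>2 b\<^sub>3 :: real
    and \<omega> :: "(real^2) set"
    and y\<^sub>0 :: "real^2 \<Rightarrow> real^3"
    and Q :: "real^2 \<Rightarrow> real^3^3"
    and x :: "real^2"
  assumes "\<mu> > 0" "L\<^sub>c > 0" "b\<^sub>1 > 0" "b\<^sub>2 > 0" "b\<^sub>3 > 0"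
    and "bounded_lipschitz_domain \<omega>"
    and "C2_on \<omega> y\<^sub>0"
    and "\<And>z. z \<in> \<omega> \<Longrightarrow> regular_at y\<^sub>0 z"
    and "\<And>z. z \<in> \<omega> \<Longrightarrow> rotation_matrix (Q z)"
    and "x \<in> \<omega>"
    and "\<And>i. has_partial i Q x"
  shows
    "(\<exists>A\<in>so3.
        axl A = ((b\<^sub>2 - b\<^sub>1) / (b\<^sub>1 + b\<^sub>2)) *\<^sub>R (transpose (K_curv y\<^sub>0 Q x) *v unit_normal y\<^sub>0 x)
                 - (2 * b\<^sub>3 / (2 * (b\<^sub>1 + b\<^sub>3)) * trace (K_curv y\<^sub>0 Q x)) *\<^sub>R unit_normal y\<^sub>0 x \<and>
        (\<forall>B. is_arg_min (\<lambda>B. W_curv \<mu> L\<^sub>c b\<^sub>1 b\<^sub>2 b\<^sub>3 (Gamma_curv y\<^sub>0 Q x (axl B))) (\<lambda>B. B \<in> so3) B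
              \<longleftrightarrow> B = A)) \<and>
     W_hom_curv \<mu> L\<^sub>c b\<^sub>1 b\<^sub>2 b\<^sub>3 y\<^sub>0 Q x =
       \<mu> * L\<^sub>c\<^sup>2 * (b\<^sub>1 * (norm (sym_part (K_par y\<^sub>0 Q x)))\<^sup>2
                  + b\<^sub>2 * (norm (skew_part (K_par y\<^sub>0 Q x)))\<^sup>2
                  + b\<^sub>1 * b\<^sub>3 / (b\<^sub>1 + b\<^sub>3) * (trace (K_par y\<^sub>0 Q x))\<^sup>2
                  + 2 * b\<^sub>1 * b\<^sub>2 / (b\<^sub>1 + b\<^sub>2) * (norm (K_perp y\<^sub>0 Q x))\<^sup>2) \<and>
     K_curv y\<^sub>0 Q x = K_par y\<^sub>0 Q x + K_perp y\<^sub>0 Q x \<and>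
     K_par y\<^sub>0 Q x \<bullet> K_perp y\<^sub>0 Q x = 0 \<and>
     (\<forall>v. K_par y\<^sub>0 Q x *v v \<in> span {partial 1 y\<^sub>0 x, partial 2 y\<^sub>0 x}) \<and>
     (\<forall>v. K_perp y\<^sub>0 Q x *v v \<in> span {unit_normal y\<^sub>0 x})"
proof -
  let ?K = "K_curv y\<^sub>0 Q x" and ?n = "unit_normal y\<^sub>0 x"
  let ?c = "optimal_column b\<^sub>1 b\<^sub>2 b\<^sub>3 ?K ?n"
  let ?W = "\<lambda>B. W_curv \<mu> L\<^sub>c b\<^sub>1 b\<^sub>2 b\<^sub>3 (Gamma_curv y\<^sub>0 Q x (axl B))"
  have reg: "regular_at y\<^sub>0 x"
    using assms(8,10) by blast
  note Kn = K_curv_normal[OF reg, of Q] and nn = inner_unit_normal[OF reg]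
  obtain A where A: "A \<in> so3" "axl A = ?c"
    using axl_surj by blast
  have less: "?W A < ?W B" if "B \<in> so3" "B \<noteq> A" for B
  proof -
    have "axl B \<noteq> ?c"
      using that A axl_inj by metis
    then show ?thesis
      unfolding Gamma_curv_eq[OF reg] A(2) using W_curv_excess_pos[OF Kn nn] assms(1-5) by blast
  qed
  have arg_min: "is_arg_min ?W (\<lambda>B. B \<in> so3) B \<longleftrightarrow> B = A" for B
    unfolding is_arg_min_def using less A(1) by (metis less_asym)
  have "W_hom_curv \<mu> L\<^sub>c b\<^sub>1 b\<^sub>2 b\<^sub>3 y\<^sub>0 Q x = ?W A"
    unfolding W_hom_curv_def
  proof (rule cInf_eq_minimum)
    show "?W A \<in> ?W ` so3"
      using A(1) by blast
    fix w
    assume "w \<in> ?W ` so3"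
    then obtain B where "B \<in> so3" "w = ?W B"
      by blast
    then show "?W A \<le> w"
      using less[of B] by (cases "B = A") simp_all
  qed
  also have "\<dots> = \<mu> * L\<^sub>c\<^sup>2 * (b\<^sub>1 * (norm (sym_part (K_par y\<^sub>0 Q x)))\<^sup>2
      + b\<^sub>2 * (norm (skew_part (K_par y\<^sub>0 Q x)))\<^sup>2
      + b\<^sub>1 * b\<^sub>3 / (b\<^sub>1 + b\<^sub>3) * (trace (K_par y\<^sub>0 Q x))\<^sup>2
      + 2 * b\<^sub>1 * b\<^sub>2 / (b\<^sub>1 + b\<^sub>2) * (norm (K_perp y\<^sub>0 Q x))\<^sup>2)"
  proof -
    have par: "K_par y\<^sub>0 Q x = ?K - K_perp y\<^sub>0 Q x"
      by (simp add: K_curv_split[of y\<^sub>0 Q x])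
    show ?thesis
      unfolding Gamma_curv_eq[OF reg] A(2) W_curv_minimum[OF Kn nn assms(3-5)] par
        K_perp_eq[OF reg] ..
  qed
  finally have hom: "W_hom_curv \<mu> L\<^sub>c b\<^sub>1 b\<^sub>2 b\<^sub>3 y\<^sub>0 Q x = \<dots>" .
  have "axl A = ((b\<^sub>2 - b\<^sub>1) / (b\<^sub>1 + b\<^sub>2)) *\<^sub>R (transpose ?K *v ?n)
      - (2 * b\<^sub>3 / (2 * (b\<^sub>1 + b\<^sub>3)) * trace ?K) *\<^sub>R ?n"
    unfolding A(2) optimal_column_def by (simp only: mult_divide_mult_cancel_left_if) simp
  then show ?thesis
    using A(1) arg_min hom K_curv_split K_par_perp_orthogonal[OF reg] K_par_tangential
      K_perp_normal[OF reg]
    by (intro conjI bexI[of _ A] allI) auto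
qed

end
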